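(* For all integers $d\ge 0$ and $t>0$, the unary words $a^d$ and $a^{d+t}$ can be separated exactly by a 2-state AfA over $\{a\}$ whose end-marker operator $A_\$$ is the identity.
   Context: An $n$-state affine finite automaton (AfA) over a finite alphabet $\Sigma$ consists of real $n\times n$ matrices $A_\sigma$ for $\sigma\in\Sigma\cup\{\$\}$ ($\$$ a right end-marker not in $\Sigma$), each of whose columns sums to $1$; an initial vector $v_0\in\mathbb{R}^n$ whose entries sum to $1$; and a set $E_a\subseteq\{1,\dots,n\}$ of accepting states. On input $w=w_1\cdots w_k$ the final vector is $v_f=A_\$A_{w_k}\cdots A_{w_1}v_0$, and $w$ is accepted with probability $\sum_{j\in E_a}|v_f[j]|\big/\sum_{j=1}^n|v_f[j]|$. A pair of words is separated exactly if one is accepted with probability $1$ and the other with probability $0$. *)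

theory Defs
  imports "HOL-Analysis.Analysis" "HOL-Library.Numeral_Type"
begin

text \<open>An affine matrix: every column sums to 1.\<close>
definition affine_matrix :: "real^'n^'n \<Rightarrow> bool" where
  "affine_matrix A \<longleftrightarrow> (\<forall>j. (\<Sum>i\<in>UNIV. A $ i $ j) = 1)"

text \<open>An affine finite automaton over alphabet type 's with state set 'n:
  letter matrices Aw, end-marker matrix Aend, initial vector v0, accepting set E.\<close>
definition is_afa :: "('s \<Rightarrow> real^'n^'n) \<Rightarrow> real^'n^'n \<Rightarrow> real^'n \<Rightarrow> 'n set \<Rightarrow> bool" where
  "is_afa Aw Aend v0 E \<longleftrightarrow>
     (\<forall>s. affine_matrix (Aw s)) \<and> affine_matrix Aend \<and> (\<Sum>i\<in>UNIV. v0 $ i) = 1"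

text \<open>Final vector: A_end A_{w_k} ... A_{w_1} v0 (first letter applied first).\<close>
definition afa_final :: "('s \<Rightarrow> real^'n^'n) \<Rightarrow> real^'n^'n \<Rightarrow> real^'n \<Rightarrow> 's list \<Rightarrow> real^'n" where
  "afa_final Aw Aend v0 w = Aend *v fold (\<lambda>s v. Aw s *v v) w v0"

definition afa_accept_prob :: "('s \<Rightarrow> real^'n^'n) \<Rightarrow> real^'n^'n \<Rightarrow> real^'n \<Rightarrow> 'n set \<Rightarrow> 's list \<Rightarrow> real" where
  "afa_accept_prob Aw Aend v0 E w =
     (let vf = afa_final Aw Aend v0 w in
       (\<Sum>j\<in>E. \<bar>vf $ j\<bar>) / (\<Sum>j\<in>UNIV. \<bar>vf $ j\<bar>))"

text \<open>Exact separation of two words.\<close>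
definition afa_separates_exactly :: "('s \<Rightarrow> real^'n^'n) \<Rightarrow> real^'n^'n \<Rightarrow> real^'n \<Rightarrow> 'n set \<Rightarrow> 's list \<Rightarrow> 's list \<Rightarrow> bool" where
  "afa_separates_exactly Aw Aend v0 E u w \<longleftrightarrow>
     (afa_accept_prob Aw Aend v0 E u = 1 \<and> afa_accept_prob Aw Aend v0 E w = 0) \<or>
     (afa_accept_prob Aw Aend v0 E u = 0 \<and> afa_accept_prob Aw Aend v0 E w = 1)"

end

theory Submission
  imports Defs
begin

text \<open>The letter acts on the affine line \<open>v\<^sub>1 + v\<^sub>2 = 1\<close> of \<open>\<real>\<^sup>2\<close> as the translation
  \<open>(x, 1 - x) \<mapsto> (x + 1/t, 1 - x - 1/t)\<close>. Starting from \<open>x = -d/t\<close>, the word \<open>a\<^sup>k\<close> reaches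
  \<open>x = (k - d)/t\<close>, i.e. the point \<open>(0, 1)\<close> for \<open>k = d\<close> and \<open>(1, 0)\<close> for \<open>k = d + t\<close>; with the
  first state accepting these are accepted with probability 0 and 1.\<close>

lemma fold_replicate_orbit:
  assumes "\<And>k. f (x k) = x (Suc k)"
  shows "fold (\<lambda>_. f) (replicate k a) (x 0) = x k"
proof (induction k)
  case (Suc k)
  then show ?case
    by (simp add: replicate_append_same[symmetric] assms del: replicate_Suc)
qed simp

definition affine_point :: "real \<Rightarrow> real^2" where
  "affine_point x = (\<chi> i. if i = 1 then x else 1 - x)"

definition translation_matrix :: "real \<Rightarrow> real^2^2" where
  "translation_matrix c = (\<chi> i j. (if i = j then 1 else 0) + (if i = 1 then c else - c))"

lemma affine_matrix_translation_matrix: "affine_matrix (translation_matrix c)"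
  unfolding affine_matrix_def translation_matrix_def by (simp add: sum_2 forall_2)

lemma translation_matrix_affine_point:
  "translation_matrix c *v affine_point x = affine_point (x + c)"
  unfolding translation_matrix_def affine_point_def matrix_vector_mult_def
  by (simp add: vec_eq_iff forall_2 sum_2 algebra_simps)

lemma is_afa_translation:
  "is_afa (\<lambda>_. translation_matrix c) (mat 1) (affine_point x) E"
  using affine_matrix_translation_matrix
  unfolding is_afa_def by (simp add: affine_matrix_def mat_def sum_2 affine_point_def forall_2)

lemma afa_final_translation:
  "afa_final (\<lambda>_. translation_matrix c) (mat 1) (affine_point x) (replicate k a)
     = affine_point (x + real k * c)"
proof -
  have "fold (\<lambda>_. (*v) (translation_matrix c)) (replicate k a) (affine_point (x + real 0 * c))
          = affine_point (x + real k * c)"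
    by (rule fold_replicate_orbit) (simp add: translation_matrix_affine_point algebra_simps)
  then show ?thesis
    by (simp add: afa_final_def)
qed

lemma afa_accept_prob_affine_point_0:
  "afa_accept_prob Aw (mat 1) v0 {1} w = 0" if "afa_final Aw (mat 1) v0 w = affine_point 0"
  using that by (simp add: afa_accept_prob_def affine_point_def)

lemma afa_accept_prob_affine_point_1:
  "afa_accept_prob Aw (mat 1) v0 {1} w = 1" if "afa_final Aw (mat 1) v0 w = affine_point 1"
  using that by (simp add: afa_accept_prob_def affine_point_def sum_2)

theorem mainTheorem7:
  fixes d t :: nat
  assumes "t > 0"
  shows "\<exists>(Aw :: unit \<Rightarrow> real^2^2) (v0 :: real^2) (E :: 2 set).
           is_afa Aw (mat 1) v0 E \<and>
           afa_separates_exactly Aw (mat 1) v0 E (replicate d ()) (replicate (d + t) ())"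
proof -
  define Aw where "Aw = (\<lambda>_ :: unit. translation_matrix (1 / real t))"
  define v0 where "v0 = affine_point (- real d / real t)"
  have "afa_final Aw (mat 1) v0 (replicate d ()) = affine_point 0"
    by (simp add: Aw_def v0_def afa_final_translation)
  moreover have "afa_final Aw (mat 1) v0 (replicate (d + t) ()) = affine_point 1"
    using assms by (simp add: Aw_def v0_def afa_final_translation field_simps)
  ultimately have "afa_separates_exactly Aw (mat 1) v0 {1} (replicate d ()) (replicate (d + t) ())"
    unfolding afa_separates_exactly_def
    by (simp add: afa_accept_prob_affine_point_0 afa_accept_prob_affine_point_1)
  moreover have "is_afa Aw (mat 1) v0 {1}"
    by (simp add: Aw_def v0_def is_afa_translation)
  ultimately show ?thesis
    by blast
qed

end
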